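(* Let $\nu\leq\mathfrak c$ be an uncountable cardinal, $C\subseteq\mathbb R$ the Cantor set, $Q$ a countable dense subset of $C$ and $P=C\setminus Q$. If there exist a $\lambda'$-set $T\subseteq C$ (in $C$) of cardinality $\nu$ and a K-Lusin set $S$ in $P$ of cardinality $\nu$, then $C_8(\nu,\aleph_1)$ holds. Consequently, if there exists a $\lambda'$-set of cardinality $\nu$ in the Cantor set $C$, then $C_8(\nu,\aleph_1)\Leftrightarrow C_9(\nu,\aleph_1)$. Hence (in ZFC) $C_8(\aleph_1,\aleph_1)\Leftrightarrow C_9(\aleph_1,\aleph_1)$, and each of these statements is equivalent to $\mathfrak b=\aleph_1$.
   Context: $\mathfrak c=2^{\aleph_0}$; $\mathfrak b$ is the smallest cardinality of a family in $\mathbb N^{\mathbb N}$ unbounded with respect to eventual domination $\leq^*$. A set $E\subseteq X$ is a $\lambda'$-set in $X$ if for every countable set $L\subseteq X$, $L$ is a relative $G_\delta$-set in $E\cup L$. A K-Lusin set in a Polish space $X$ is an uncountable set $E\subseteq X$ with $E\cap K$ countable for every compact $K\subseteq X$. For uncountable cardinals $\kappa\leq\lambda\leq\mathfrak c$: $C_8(\lambda,\kappa)$ denotes the statement: there exist a set $E\subseteq\mathbb R$ of cardinality $\lambda$ and a continuous function $f:E\to\mathbb R$ which is not uniformly continuous on any subset of $E$ of cardinality $\kappa$. $C_9(\lambda,\kappa)$ denotes the statement: there exist a set $E\subseteq\mathbb R$ of cardinality $\lambda$ and a sequence of functions $f_n:E\to\mathbb R$ converging pointwise on $E$ but not converging uniformly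 on any subset of $E$ of cardinality $\kappa$. *)

theory Defs
  imports "HOL-Analysis.Analysis"
begin

unbundle cardinal_syntax

(* Cardinals are cardinal orders (up to =o): a cardinal kappa is a relation with Card_order kappa,
   and a set A has cardinality kappa iff |A| =o kappa. *)

abbreviation aleph1 :: "nat set rel"
  where "aleph1 \<equiv> cardSuc natLeq"

abbreviation continuum :: "real rel"
  where "continuum \<equiv> |UNIV :: real set|"

definition eventually_dominated :: "(nat \<Rightarrow> nat) \<Rightarrow> (nat \<Rightarrow> nat) \<Rightarrow> bool"
  where "eventually_dominated f g \<longleftrightarrow> (\<forall>\<^sub>F n in sequentially. f n \<le> g n)"

definition unbounded_family :: "(nat \<Rightarrow> nat) set \<Rightarrow> bool"
  where "unbounded_family F \<longleftrightarrow> \<not> (\<exists>g. \<forall>f\<in>F. eventually_dominated f g)"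

definition bounding_number :: "(nat \<Rightarrow> nat) rel"
  where "bounding_number =
    |SOME F. unbounded_family F \<and> (\<forall>G. unbounded_family G \<longrightarrow> |F| \<le>o |G| )|"

lemma unbounded_family_UNIV: "unbounded_family UNIV"
proof -
  have "\<not> eventually_dominated (\<lambda>n. Suc (g n)) g" for g
    by (simp add: eventually_dominated_def)
  then show ?thesis
    unfolding unbounded_family_def by blast
qed

(* The choice in the definition of bounding_number is not vacuous. *)
lemma bounding_number_minimal:
  "\<exists>F. unbounded_family F \<and> bounding_number = |F|"
  "unbounded_family G \<Longrightarrow> bounding_number \<le>o |G|"
proof -
  let ?R = "card_of ` Collect unbounded_family"
  have "?R \<noteq> {}" "\<forall>r\<in>?R. Card_order r"
    using unbounded_family_UNIV by (auto intro: card_of_Card_order)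
  then have "\<exists>r\<in>?R. \<forall>r'\<in>?R. r \<le>o r'"
    by (rule exists_minim_Card_order)
  then have "\<exists>F. unbounded_family F \<and> (\<forall>G. unbounded_family G \<longrightarrow> |F| \<le>o |G| )"
    by auto
  from someI_ex[OF this]
  show "\<exists>F. unbounded_family F \<and> bounding_number = |F|"
    and "unbounded_family G \<Longrightarrow> bounding_number \<le>o |G|"
    unfolding bounding_number_def by blast+
qed

(* The ternary Cantor set, as the numbers in [0,1] having a ternary expansion with digits 0 and 2. *)
definition cantor_set :: "real set"
  where "cantor_set = range (\<lambda>d :: nat \<Rightarrow> bool. \<Sum>n. (if d n then 2 else 0) / 3 ^ Suc n)"

definition lambda_prime_set_in :: "'a topology \<Rightarrow> 'a set \<Rightarrow> bool"
  where "lambda_prime_set_in X E \<longleftrightarrow> E \<subseteq> topspace X \<and>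
    (\<forall>L. L \<subseteq> topspace X \<and> countable L \<longrightarrow> gdelta_in (subtopology X (E \<union> L)) L)"

(* Intended for Polish spaces X; Polishness is a property of X and not part of the definition. *)
definition K_Lusin_set_in :: "'a topology \<Rightarrow> 'a set \<Rightarrow> bool"
  where "K_Lusin_set_in X E \<longleftrightarrow> E \<subseteq> topspace X \<and> uncountable E \<and>
    (\<forall>K. compactin X K \<longrightarrow> countable (E \<inter> K))"

(* Functions on E are represented by total functions; only their values on E matter.
   Both statements are meant for uncountable cardinals \<kappa> \<le> \<mu> \<le> continuum. *)
definition C8 :: "'a rel \<Rightarrow> 'b rel \<Rightarrow> bool"
  where "C8 \<mu> \<kappa> \<longleftrightarrow> (\<exists>(E :: real set) (f :: real \<Rightarrow> real).
    |E| =o \<mu> \<and> continuous_on E f \<and>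
    (\<forall>A. A \<subseteq> E \<and> |A| =o \<kappa> \<longrightarrow> \<not> uniformly_continuous_on A f))"

definition C9 :: "'a rel \<Rightarrow> 'b rel \<Rightarrow> bool"
  where "C9 \<mu> \<kappa> \<longleftrightarrow> (\<exists>(E :: real set) (f :: nat \<Rightarrow> real \<Rightarrow> real).
    |E| =o \<mu> \<and> (\<forall>x\<in>E. convergent (\<lambda>n. f n x)) \<and>
    (\<forall>A. A \<subseteq> E \<and> |A| =o \<kappa> \<longrightarrow> \<not> uniformly_convergent_on A f))"

end

theory Submission
  imports Defs "HOL-Library.Countable_Set_Type"
begin

text \<open>
  Both \<open>C8\<close> and \<open>C9\<close> yield a family of functions \<open>h x :: nat \<Rightarrow> nat\<close> (moduli of continuity or
  of convergence at \<open>x \<in> E\<close>) such that every single function bounds only countably many of them, and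
  such a family gives back \<open>C9\<close>. For a K-Lusin set in \<open>cantor_set - Q\<close>, the distances to
  the points of \<open>Q\<close> provide such a family. Given a \<open>\<lambda>'\<close>-set \<open>T\<close> as well, one codes \<open>t\<close>
  together with \<open>h t\<close> by a point of the Cantor set with infinitely many nonzero digits; the map
  from codes to \<open>T\<close> witnesses \<open>C8\<close>. For \<open>\<aleph>\<^sub>1\<close>, the family exists iff \<open>\<bb> = \<aleph>\<^sub>1\<close>, and a
  \<open>\<lambda>'\<close>-set always exists: a Hausdorff gap gives a decreasing \<open>\<omega>\<^sub>1\<close>-sequence of \<open>F\<^sub>\<sigma>\<close> sets with
  empty intersection, and one picks a point from each of them.
\<close>

section \<open>Cardinals\<close>

lemma Card_order_aleph1: "Card_order aleph1"
  by (rule cardSuc_Card_order[OF natLeq_Card_order])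

lemma card_of_Field_aleph1: "|Field aleph1| =o aleph1"
  by (rule card_of_Field_ordIso[OF Card_order_aleph1])

lemma uncountable_aleph1:
  assumes "|A| =o aleph1"
  shows "uncountable A"
proof -
  have "natLeq <o |A|"
    using assms cardSuc_greater[OF natLeq_Card_order] ordIso_symmetric ordLess_ordIso_trans by blast
  then show ?thesis
    using countable_card_le_natLeq not_ordLess_ordLeq by blast
qed

lemma aleph1_le_uncountable:
  assumes "uncountable A"
  shows "aleph1 \<le>o |A|"
proof -
  have "natLeq <o |A|"
    using assms countable_card_le_natLeq not_ordLeq_iff_ordLess card_of_Well_order natLeq_Well_order by blast
  then show ?thesis
    using cardSuc_least card_of_Card_order natLeq_Card_order by blast
qed

text \<open>\<open>C8\<close> and \<open>C9\<close> speak of sets of cardinality exactly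
  \<open>aleph1\<close>, while the arguments by contradiction yield merely uncountable ones.\<close>

lemma subset_aleph1:
  assumes "uncountable A"
  shows "\<exists>B\<subseteq>A. |B| =o aleph1"
proof -
  have "aleph1 \<le>o |A|"
    using assms by (rule aleph1_le_uncountable)
  then have "|Field aleph1| \<le>o |A|"
    using card_of_Field_aleph1 ordIso_ordLeq_trans by blast
  then obtain f where f: "inj_on f (Field aleph1)" "f ` Field aleph1 \<subseteq> A"
    using card_of_ordLeq by metis
  have "|f ` Field aleph1| =o |Field aleph1|"
    using f(1) card_of_ordIso[THEN iffD1, OF exI, OF inj_on_imp_bij_betw[OF f(1)]] ordIso_symmetric by blast
  then have "|f ` Field aleph1| =o aleph1"
    using card_of_Field_aleph1 ordIso_transitive by blast
  then show ?thesis
    using f(2) by blast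
qed

section \<open>The Cantor set\<close>

definition cantor_map :: "(nat \<Rightarrow> bool) \<Rightarrow> real"
  where "cantor_map d = (\<Sum>n. (if d n then 2 else 0) / 3 ^ Suc n)"

lemma cantor_set_eq: "cantor_set = range cantor_map"
  by (simp add: cantor_set_def cantor_map_def)

lemma sums_cantor_bound: "(\<lambda>n. 2 / 3 ^ Suc n :: real) sums 1"
  using sums_mult[OF geometric_sums[of "1/3::real"], of "2/3"]
  by (simp add: power_divide)

lemma summable_cantor: "summable (\<lambda>n. (if d n then 2 else 0) / 3 ^ Suc n :: real)"
  by (rule summable_comparison_test'[OF sums_summable[OF sums_cantor_bound], of 0]) auto

lemma cantor_map_nonneg: "0 \<le> cantor_map d"
  unfolding cantor_map_def by (intro suminf_nonneg summable_cantor) auto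

lemma cantor_map_le_1: "cantor_map d \<le> 1"
proof -
  have "cantor_map d \<le> (\<Sum>n. 2 / 3 ^ Suc n)"
    unfolding cantor_map_def
    by (intro suminf_le summable_cantor sums_summable[OF sums_cantor_bound]) (auto simp: divide_right_mono)
  then show ?thesis
    using sums_unique[OF sums_cantor_bound] by simp
qed

lemma cantor_map_shift:
  "cantor_map d = cantor_map (\<lambda>n. d (n + N)) / 3 ^ N + (\<Sum>i<N. (if d i then 2 else 0) / 3 ^ Suc i)"
proof -
  have "(\<Sum>n. (if d (n + N) then 2 else 0) / 3 ^ Suc (n + N) :: real)
      = (\<Sum>n. ((if d (n + N) then 2 else 0) / 3 ^ Suc n) / 3 ^ N)"
    by (intro suminf_cong) (simp add: power_add)
  also have "\<dots> = cantor_map (\<lambda>n. d (n + N)) / 3 ^ N"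
    unfolding cantor_map_def by (rule suminf_divide[OF summable_cantor])
  finally show ?thesis
    using suminf_split_initial_segment[OF summable_cantor[of d], of N]
    by (simp add: cantor_map_def)
qed

lemma cantor_map_diff:
  assumes "\<forall>i<N. d i = d' i"
  shows "\<bar>cantor_map d - cantor_map d'\<bar> = \<bar>cantor_map (\<lambda>n. d (n + N)) - cantor_map (\<lambda>n. d' (n + N))\<bar> / 3 ^ N"
proof -
  have "(\<Sum>i<N. (if d i then 2 else 0) / 3 ^ Suc i :: real) = (\<Sum>i<N. (if d' i then 2 else 0) / 3 ^ Suc i)"
    using assms by (intro sum.cong) auto
  then have "cantor_map d - cantor_map d' = (cantor_map (\<lambda>n. d (n + N)) - cantor_map (\<lambda>n. d' (n + N))) / 3 ^ N"
    using cantor_map_shift[of d N] cantor_map_shift[of d' N] by (simp add: diff_divide_distrib)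
  then show ?thesis
    by simp
qed

lemma cantor_map_close:
  assumes "\<forall>i<N. d i = d' i"
  shows "\<bar>cantor_map d - cantor_map d'\<bar> \<le> 1 / 3 ^ N"
proof -
  have "\<bar>cantor_map (\<lambda>n. d (n + N)) - cantor_map (\<lambda>n. d' (n + N))\<bar> \<le> 1"
    using cantor_map_nonneg[of "\<lambda>n. d (n + N)"] cantor_map_le_1[of "\<lambda>n. d (n + N)"]
      cantor_map_nonneg[of "\<lambda>n. d' (n + N)"] cantor_map_le_1[of "\<lambda>n. d' (n + N)"] by linarith
  then show ?thesis
    unfolding cantor_map_diff[OF assms] by (rule divide_right_mono) simp
qed

text \<open>The tails lie in \<open>[0, 1]\<close>, so the first digit places a point in
  \<open>[0, 1/3]\<close> or in \<open>[2/3, 1]\<close>.\<close>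

lemma cantor_map_far:
  assumes "d 0 \<noteq> d' 0"
  shows "1 / 3 \<le> \<bar>cantor_map d - cantor_map d'\<bar>"
  using cantor_map_shift[of d 1] cantor_map_shift[of d' 1] assms
    cantor_map_nonneg[of "\<lambda>n. d (n + 1)"] cantor_map_le_1[of "\<lambda>n. d (n + 1)"]
    cantor_map_nonneg[of "\<lambda>n. d' (n + 1)"] cantor_map_le_1[of "\<lambda>n. d' (n + 1)"]
  by (auto split: if_splits)

text \<open>At the first differing digit \<open>j\<close> the common prefix cancels and the points
  are at least \<open>1 / 3 ^ Suc j\<close> apart. With \<open>cantor_map_close\<close>, nearness in
  the Cantor set thus amounts to a long common prefix.\<close>

lemma cantor_map_agree:
  assumes "\<bar>cantor_map d - cantor_map d'\<bar> < 1 / 3 ^ N" "i < N"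
  shows "d i = d' i"
proof (rule ccontr)
  assume "d i \<noteq> d' i"
  define j where "j = (LEAST j. d j \<noteq> d' j)"
  have j: "d j \<noteq> d' j" "\<forall>i<j. d i = d' i"
    unfolding j_def using LeastI[of "\<lambda>j. d j \<noteq> d' j", OF \<open>d i \<noteq> d' i\<close>] not_less_Least by blast+
  have "j < N"
    using Least_le[of "\<lambda>j. d j \<noteq> d' j", OF \<open>d i \<noteq> d' i\<close>] assms(2) by (simp add: j_def)
  have "1 / 3 ^ N \<le> (1 / 3 :: real) ^ Suc j"
    using \<open>j < N\<close> power_decreasing[of "Suc j" N "1/3::real"] by (simp add: power_one_over)
  also have "\<dots> = (1 / 3) / 3 ^ j"
    by (simp add: power_one_over)
  also have "\<dots> \<le> \<bar>cantor_map d - cantor_map d'\<bar>"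
    unfolding cantor_map_diff[OF j(2)]
    by (intro divide_right_mono cantor_map_far) (use j in auto)
  finally show False
    using assms(1) by simp
qed

lemma inj_cantor_map: "inj cantor_map"
  by (intro injI ext) (rule cantor_map_agree[of _ _ "Suc n" n for n], auto)

lemma closed_cantor_set: "closed cantor_set"
proof -
  have "x \<in> cantor_set" if x: "x \<in> closure cantor_set" for x
  proof -
    have "\<exists>d. dist (cantor_map d) x < 1 / 3 ^ N / 2" for N
      using x[unfolded closure_approachable, rule_format, of "1 / 3 ^ N / 2"]
      by (auto simp: cantor_set_eq)
    then obtain d where d: "\<And>N. dist (cantor_map (d N)) x < 1 / 3 ^ N / 2"
      by metis
    have agree: "d N i = d M i" if "i < N" "N \<le> M" for N M i
    proof (rule cantor_map_agree[OF _ that(1)])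
      have "(1 / 3 ^ M / 2 :: real) \<le> 1 / 3 ^ N / 2"
        using that(2) by (intro divide_right_mono frac_le power_increasing) auto
      then have "dist (cantor_map (d M)) x < 1 / 3 ^ N / 2"
        using d[of M] by (rule order_less_le_trans[rotated])
      then have "dist (cantor_map (d N)) (cantor_map (d M)) < 1 / 3 ^ N"
        by (rule dist_triangle_half_l[OF d])
      then show "\<bar>cantor_map (d N) - cantor_map (d M)\<bar> < 1 / 3 ^ N"
        by (simp add: dist_real_def)
    qed
    \<comment> \<open>The approximation \<open>d N\<close> is reliable only at digits below
      \<open>N\<close>, so digit \<open>n\<close> is read off at stage \<open>Suc n\<close>.\<close>
    define e where "e n = d (Suc n) n" for n
    have e: "dist (cantor_map e) x \<le> 2 * (1 / 3) ^ N" for N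
    proof -
      have "\<forall>i<N. e i = d N i"
        using agree by (auto simp: e_def)
      then have "dist (cantor_map e) (cantor_map (d N)) \<le> 1 / 3 ^ N"
        unfolding dist_real_def by (rule cantor_map_close)
      moreover have "dist (cantor_map (d N)) x \<le> 1 / 3 ^ N"
        by (rule order_trans[OF less_imp_le[OF d]]) (simp add: divide_simps)
      ultimately have "dist (cantor_map e) x \<le> 1 / 3 ^ N + 1 / 3 ^ N"
        using dist_triangle[of "cantor_map e" x "cantor_map (d N)"] by linarith
      then show ?thesis
        by (simp add: power_one_over)
    qed
    have "(\<lambda>N. 2 * (1 / 3) ^ N :: real) \<longlonglongrightarrow> 2 * 0"
      by (intro tendsto_intros LIMSEQ_power_zero) auto
    then have "dist (cantor_map e) x \<le> 2 * 0"
      by (rule LIMSEQ_le_const) (use e in auto)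
    then show ?thesis
      by (auto simp: cantor_set_eq)
  qed
  then show ?thesis
    by (metis closure_subset closure_closed closed_closure subsetI subset_antisym)
qed

lemma compact_cantor_set: "compact cantor_set"
proof -
  have "cantor_set \<subseteq> {0..1}"
    using cantor_map_nonneg cantor_map_le_1 by (auto simp: cantor_set_eq)
  then show ?thesis
    using closed_cantor_set compact_eq_bounded_closed bounded_closed_interval bounded_subset by metis
qed

lemma countable_finite_digits: "countable (cantor_map ` {d. finite {n. d n}})"
proof -
  have "{d. finite {n. d n}} \<subseteq> (\<lambda>F n. n \<in> F) ` {F :: nat set. finite F}"
    by (force intro: image_eqI[where x = "{n. d n}" for d])
  then show ?thesis
    by (meson countable_Collect_finite countable_image countable_subset)
qed

section \<open>Increasing sequences coded by points of the Cantor set\<close>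

lemma strict_mono_range_agree:
  fixes r r' :: "nat \<Rightarrow> nat"
  assumes "strict_mono r" "strict_mono r'"
    and agree: "\<forall>i\<le>r n. i \<in> range r \<longleftrightarrow> i \<in> range r'"
  shows "k \<le> n \<Longrightarrow> r' k = r k"
proof (induction k rule: less_induct)
  case (less k)
  have "r k \<le> r n"
    using less.prems assms(1) by (simp add: strict_mono_less_eq)
  then obtain l where l: "r k = r' l"
    using agree by blast
  \<comment> \<open>If \<open>l < k\<close>, the induction hypothesis would give
    \<open>r k = r' l = r l\<close>, against strict monotonicity of \<open>r\<close>. The bound on
    \<open>m\<close> below is symmetric.\<close>
  have "k \<le> l"
    by (metis assms(1) l less.IH less.prems less_le_trans linorder_not_less nless_le strict_mono_less)
  then have le: "r' k \<le> r k"
    using assms(2) l by (simp add: strict_mono_less_eq)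
  then obtain m where m: "r' k = r m"
    using agree \<open>r k \<le> r n\<close> by (metis le_trans rangeE rangeI)
  have "k \<le> m"
    by (metis assms(2) m less.IH less.prems less_le_trans linorder_not_less nless_le strict_mono_less)
  then show ?case
    using le m assms(1) by (simp add: strict_mono_less_eq)
qed

text \<open>On strictly increasing sequences this is the usual homeomorphism onto the Cantor points
  with infinitely many nonzero digits, a copy of Baire space.\<close>

definition cantor_code :: "(nat \<Rightarrow> nat) \<Rightarrow> real"
  where "cantor_code r = cantor_map (\<lambda>m. m \<in> range r)"

text \<open>Agreement of the first \<open>Suc (r n)\<close> digits fixes the range up to and
  including \<open>r n\<close>. The radius depends on \<open>r\<close> alone, as continuity at a
  point and coverings by balls require.\<close>

lemma cantor_code_close:
  assumes "strict_mono r" "strict_mono r'" "\<bar>cantor_code r - cantor_code r'\<bar> < 1 / 3 ^ Suc (r n)" "k \<le> n"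
  shows "r' k = r k"
proof (rule strict_mono_range_agree[OF assms(1,2) _ assms(4)])
  show "\<forall>i\<le>r n. (i \<in> range r) = (i \<in> range r')"
    using cantor_map_agree[OF assms(3)[unfolded cantor_code_def]] by simp
qed

text \<open>Each coordinate of the coded sequence is locally constant by
  \<open>cantor_code_close\<close>, so it takes finitely many values on a compact set. This is the
  boundedness of compact sets in Baire space.\<close>

lemma compact_code_bounded:
  assumes "compact M" and M: "M \<subseteq> cantor_map ` {d. infinite {n. d n}}"
  shows "\<exists>m. \<forall>r. strict_mono r \<and> cantor_code r \<in> M \<longrightarrow> r n \<le> m"
proof -
  have "\<exists>r. strict_mono r \<and> z = cantor_code r" if "z \<in> M" for z
  proof -
    obtain d where d: "infinite {n. d n}" "z = cantor_map d"
      using M \<open>z \<in> M\<close> by blast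
    then show ?thesis
      by (intro exI[of _ "enumerate {n. d n}"])
        (simp add: cantor_code_def range_enumerate strict_mono_enumerate)
  qed
  then obtain \<rho> where \<rho>: "\<And>z. z \<in> M \<Longrightarrow> strict_mono (\<rho> z)" "\<And>z. z \<in> M \<Longrightarrow> z = cantor_code (\<rho> z)"
    by metis
  have "M \<subseteq> (\<Union>z\<in>M. ball z (1 / 3 ^ Suc (\<rho> z n)))"
    by auto
  then obtain M' where M': "M' \<subseteq> M" "finite M'" "M \<subseteq> (\<Union>z\<in>M'. ball z (1 / 3 ^ Suc (\<rho> z n)))"
    using compactE_image[OF \<open>compact M\<close>, of M "\<lambda>z. ball z (1 / 3 ^ Suc (\<rho> z n))"] by auto
  have "r n \<le> Max ((\<lambda>z. \<rho> z n) ` M')" if r: "strict_mono r" "cantor_code r \<in> M" for r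
  proof -
    obtain z where z: "z \<in> M'" "\<bar>z - cantor_code r\<bar> < 1 / 3 ^ Suc (\<rho> z n)"
      using M'(3) r(2) by (auto simp: dist_real_def)
    then have "r n = \<rho> z n"
      using cantor_code_close[of "\<rho> z" r n n] r(1) \<rho>[of z] M'(1) by auto
    then show ?thesis
      using z(1) M'(2) by simp
  qed
  then show ?thesis
    by blast
qed

section \<open>Families with countable bounded parts\<close>

text \<open>The functions below a fixed \<open>g\<close> form a compact set, and every compact
  subset of Baire space lies in such a set. So this is the K-Lusin condition in Baire space, for
  indexed families in which a function may occur countably often.\<close>

definition countable_on_bounded :: "'i set \<Rightarrow> ('i \<Rightarrow> nat \<Rightarrow> nat) \<Rightarrow> bool"
  where "countable_on_bounded I h \<longleftrightarrow> (\<forall>g. countable {i \<in> I. \<forall>n. h i n \<le> g n})"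

text \<open>A common bound for the pointwise moduli of continuity on a set is a uniform modulus
  there.\<close>

lemma C8_imp_countable_on_bounded:
  fixes \<nu> :: "'k rel"
  assumes "C8 \<nu> aleph1"
  shows "\<exists>(E :: real set) h. |E| =o \<nu> \<and> countable_on_bounded E h"
proof -
  obtain E :: "real set" and f :: "real \<Rightarrow> real" where Ef: "|E| =o \<nu> \<and> continuous_on E f \<and>
    (\<forall>A. A \<subseteq> E \<and> |A| =o aleph1 \<longrightarrow> \<not> uniformly_continuous_on A f)"
    using assms unfolding C8_def by (elim exE) (erule that)
  then have E: "|E| =o \<nu>" and cont: "continuous_on E f"
    and not_uc: "\<And>A. A \<subseteq> E \<Longrightarrow> |A| =o aleph1 \<Longrightarrow> \<not> uniformly_continuous_on A f"
    by simp_all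
  have "\<exists>k. \<forall>y\<in>E. dist y x < 1 / real (Suc k) \<longrightarrow> dist (f y) (f x) < 1 / real (Suc n)"
    if "x \<in> E" for x n
  proof -
    obtain \<delta> where \<delta>: "\<delta> > 0" "\<And>y. y \<in> E \<Longrightarrow> dist y x < \<delta> \<Longrightarrow> dist (f y) (f x) < 1 / real (Suc n)"
      using cont[unfolded continuous_on_iff, rule_format, OF \<open>x \<in> E\<close>, of "1 / real (Suc n)"]
      by (auto simp del: of_nat_Suc)
    obtain k where "1 / real (Suc k) < \<delta>"
      using nat_approx_posE[OF \<delta>(1)] by blast
    then show ?thesis
      using \<delta>(2) by (meson order_less_trans)
  qed
  then obtain h where h: "\<And>x n y. x \<in> E \<Longrightarrow> y \<in> E \<Longrightarrow> dist y x < 1 / real (Suc (h x n)) \<Longrightarrow>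
      dist (f y) (f x) < 1 / real (Suc n)"
    by metis
  have "countable {x \<in> E. \<forall>n. h x n \<le> g n}" for g
  proof (rule ccontr)
    assume "uncountable {x \<in> E. \<forall>n. h x n \<le> g n}"
    then obtain A where A: "A \<subseteq> {x \<in> E. \<forall>n. h x n \<le> g n}" "|A| =o aleph1"
      using subset_aleph1 by blast
    have "uniformly_continuous_on A f"
      unfolding uniformly_continuous_on_def
    proof (intro allI impI)
      fix e :: real assume "0 < e"
      obtain n where n: "1 / real (Suc n) < e"
        using nat_approx_posE[OF \<open>0 < e\<close>] by blast
      have "dist (f y) (f x) < e" if "x \<in> A" "y \<in> A" "dist y x < 1 / real (Suc (g n))" for x y
      proof -
        have "1 / real (Suc (g n)) \<le> 1 / real (Suc (h x n))"
          using A(1) that(1) by (intro divide_left_mono) auto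
        then have "dist (f y) (f x) < 1 / real (Suc n)"
          using A(1) that by (intro h) auto
        then show ?thesis
          using n by simp
      qed
      then show "\<exists>\<delta>>0. \<forall>x\<in>A. \<forall>y\<in>A. dist y x < \<delta> \<longrightarrow> dist (f y) (f x) < e"
        by (intro exI[of _ "1 / real (Suc (g n))"]) auto
    qed
    then show False
      using not_uc[of A] A by blast
  qed
  then show ?thesis
    using E unfolding countable_on_bounded_def by blast
qed

lemma C9_imp_countable_on_bounded:
  fixes \<nu> :: "'k rel"
  assumes "C9 \<nu> aleph1"
  shows "\<exists>(E :: real set) h. |E| =o \<nu> \<and> countable_on_bounded E h"
proof -
  obtain E :: "real set" and f :: "nat \<Rightarrow> real \<Rightarrow> real" where Ef: "|E| =o \<nu> \<and>
    (\<forall>x\<in>E. convergent (\<lambda>n. f n x)) \<and>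
    (\<forall>A. A \<subseteq> E \<and> |A| =o aleph1 \<longrightarrow> \<not> uniformly_convergent_on A f)"
    using assms unfolding C9_def by (elim exE) (erule that)
  then have E: "|E| =o \<nu>" and conv: "\<And>x. x \<in> E \<Longrightarrow> convergent (\<lambda>n. f n x)"
    and not_uc: "\<And>A. A \<subseteq> E \<Longrightarrow> |A| =o aleph1 \<Longrightarrow> \<not> uniformly_convergent_on A f"
    by simp_all
  have "\<exists>N. \<forall>m\<ge>N. dist (f m x) (lim (\<lambda>n. f n x)) < 1 / real (Suc n)" if "x \<in> E" for x n
    using conv[OF that] unfolding convergent_LIMSEQ_iff lim_sequentially by simp
  then obtain h where h: "\<And>x n m. x \<in> E \<Longrightarrow> h x n \<le> m \<Longrightarrow>
      dist (f m x) (lim (\<lambda>n. f n x)) < 1 / real (Suc n)"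
    by metis
  have "countable {x \<in> E. \<forall>n. h x n \<le> g n}" for g
  proof (rule ccontr)
    assume "uncountable {x \<in> E. \<forall>n. h x n \<le> g n}"
    then obtain A where A: "A \<subseteq> {x \<in> E. \<forall>n. h x n \<le> g n}" "|A| =o aleph1"
      using subset_aleph1 by blast
    have "uniform_limit A f (\<lambda>x. lim (\<lambda>n. f n x)) sequentially"
    proof (rule uniform_limitI)
      fix e :: real assume "0 < e"
      obtain n where n: "1 / real (Suc n) < e"
        using nat_approx_posE[OF \<open>0 < e\<close>] by blast
      have "dist (f m x) (lim (\<lambda>n. f n x)) < e" if "g n \<le> m" "x \<in> A" for m x
      proof -
        have "x \<in> E" "h x n \<le> m"
          using A(1) that le_trans by blast+
        then show ?thesis
          using h n less_trans by blast
      qed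
      then show "\<forall>\<^sub>F m in sequentially. \<forall>x\<in>A. dist (f m x) (lim (\<lambda>n. f n x)) < e"
        unfolding eventually_sequentially by blast
    qed
    then show False
      using not_uc A unfolding uniformly_convergent_on_def by blast
  qed
  then show ?thesis
    using E unfolding countable_on_bounded_def by blast
qed

text \<open>The functions are built so that \<open>f N x < 1 / Suc k\<close> holds iff
  \<open>h x j \<le> N\<close> for all \<open>j \<le> k\<close>. Hence they tend to 0 at each point,
  and a rate of uniform convergence on \<open>A\<close> is a common bound for the \<open>h x\<close>
  with \<open>x\<close> in \<open>A\<close>.\<close>

lemma C9_if_countable_on_bounded:
  fixes E :: "real set" and \<nu> :: "'k rel"
  assumes E: "|E| =o \<nu>" and h: "countable_on_bounded E h"
  shows "C9 \<nu> aleph1"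
proof -
  \<comment> \<open>The reciprocal records the first place where \<open>h x\<close> exceeds
    \<open>N\<close>; the value is 0 if there is none.\<close>
  define f where "f N x = (if \<exists>k. N < h x k then 1 / real (Suc (LEAST k. N < h x k)) else 0)" for N x
  have f_small: "f N x < 1 / real (Suc k)" if "\<forall>j\<le>k. h x j \<le> N" for N x k
  proof (cases "\<exists>k. N < h x k")
    case True
    then have "N < h x (LEAST k. N < h x k)"
      by (rule LeastI_ex)
    then have "k < (LEAST k. N < h x k)"
      using that by (meson linorder_not_less)
    then show ?thesis
      using True by (simp add: f_def frac_less2)
  qed (simp add: f_def)
  have f_large: "1 / real (Suc k) \<le> f N x" if "N < h x k" for N x k
    using that Least_le[of "\<lambda>k. N < h x k" k] by (auto simp: f_def frac_le)
  have f_nonneg: "0 \<le> f N x" for N x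
    by (simp add: f_def)
  have lim: "(\<lambda>n. f n x) \<longlonglongrightarrow> 0" for x
  proof (rule LIMSEQ_I)
    fix e :: real assume "0 < e"
    obtain k where k: "1 / real (Suc k) < e"
      using nat_approx_posE[OF \<open>0 < e\<close>] by blast
    have "norm (f n x - 0) < e" if "Max (h x ` {..k}) \<le> n" for n
    proof -
      have "\<forall>j\<le>k. h x j \<le> n"
        using that by simp
      then show ?thesis
        using f_small[of k x n] f_nonneg[of n x] k by simp
    qed
    then show "\<exists>no. \<forall>n\<ge>no. norm (f n x - 0) < e"
      by blast
  qed
  have "\<not> uniformly_convergent_on A f" if A: "A \<subseteq> E" "|A| =o aleph1" for A
  proof
    assume "uniformly_convergent_on A f"
    then obtain l where l: "uniform_limit A f l sequentially"
      unfolding uniformly_convergent_on_def by blast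
    have l0: "l x = 0" if "x \<in> A" for x
      using tendsto_uniform_limitI[OF l that] lim LIMSEQ_unique by blast
    have "\<exists>N. \<forall>x\<in>A. f N x < 1 / real (Suc k)" for k
    proof -
      have "\<forall>\<^sub>F N in sequentially. \<forall>x\<in>A. dist (f N x) (l x) < 1 / real (Suc k)"
        by (rule uniform_limitD[OF l]) simp
      then obtain N where "\<forall>x\<in>A. dist (f N x) (l x) < 1 / real (Suc k)"
        unfolding eventually_sequentially by blast
      then show ?thesis
        using l0 f_nonneg by (intro exI[of _ N]) (simp add: dist_real_def)
    qed
    then obtain g where "\<And>k x. x \<in> A \<Longrightarrow> f (g k) x < 1 / real (Suc k)"
      by metis
    then have "\<forall>k. h x k \<le> g k" if "x \<in> A" for x
      using f_large that by (meson linorder_not_less)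
    then have "A \<subseteq> {x \<in> E. \<forall>k. h x k \<le> g k}"
      using A(1) by blast
    then show False
      using h uncountable_aleph1[OF A(2)] countable_subset unfolding countable_on_bounded_def by blast
  qed
  then show ?thesis
    unfolding C9_def using E lim by (meson convergentI)
qed

lemma K_Lusin_imp_countable_on_bounded:
  assumes S: "K_Lusin_set_in (top_of_set (cantor_set - Q)) S" and "countable Q"
  shows "\<exists>h. countable_on_bounded S h"
proof -
  have S_sub: "S \<subseteq> cantor_set - Q"
    using S by (simp add: K_Lusin_set_in_def)
  have "\<exists>k. \<forall>q\<in>Q. to_nat_on Q q = n \<longrightarrow> 1 / real (Suc k) \<le> dist x q" if "x \<in> S" for x n
  proof (cases "\<exists>q\<in>Q. to_nat_on Q q = n")
    case True
    then obtain q where q: "q \<in> Q" "to_nat_on Q q = n"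
      by blast
    then have "0 < dist x q"
      using \<open>x \<in> S\<close> S_sub by auto
    then obtain k where "1 / real (Suc k) < dist x q"
      using nat_approx_posE by blast
    then show ?thesis
      using q \<open>countable Q\<close> inj_on_to_nat_on[THEN inj_onD] by (metis less_imp_le)
  qed blast
  then obtain h where h: "\<And>x q. x \<in> S \<Longrightarrow> q \<in> Q \<Longrightarrow> 1 / real (Suc (h x (to_nat_on Q q))) \<le> dist x q"
    by metis
  have "countable {x \<in> S. \<forall>n. h x n \<le> g n}" for g
  proof -
    \<comment> \<open>Keeping a prescribed positive distance from each point of \<open>Q\<close> is
      a closed condition that excludes \<open>Q\<close> itself, so \<open>K\<close> is compact in
      \<open>cantor_set - Q\<close>.\<close>
    define K where "K = cantor_set \<inter> (\<Inter>q\<in>Q. {x. 1 / real (Suc (g (to_nat_on Q q))) \<le> dist x q})"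
    have K_Q: "x \<notin> Q" if "x \<in> K" for x
    proof
      assume "x \<in> Q"
      then have "1 / real (Suc (g (to_nat_on Q x))) \<le> dist x x"
        using that by (auto simp: K_def)
      then show False
        by simp
    qed
    have "compact K"
      unfolding K_def
      by (intro compact_Int_closed compact_cantor_set closed_INT ballI closed_Collect_le continuous_intros)
    moreover have "K \<subseteq> cantor_set - Q"
      using K_Q by (auto simp: K_def)
    ultimately have "countable (S \<inter> K)"
      using S by (simp add: K_Lusin_set_in_def compactin_subtopology)
    moreover have "x \<in> S \<inter> K" if x: "x \<in> S" "\<forall>n. h x n \<le> g n" for x
    proof -
      have "1 / real (Suc (g (to_nat_on Q q))) \<le> dist x q" if "q \<in> Q" for q
      proof -
        have "1 / real (Suc (g (to_nat_on Q q))) \<le> 1 / real (Suc (h x (to_nat_on Q q)))"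
          using x(2) by (intro divide_left_mono) auto
        then show ?thesis
          using h[OF x(1) that] by linarith
      qed
      then show ?thesis
        using x S_sub by (auto simp: K_def)
    qed
    ultimately show ?thesis
      by (elim countable_subset[rotated]) blast
  qed
  then show ?thesis
    unfolding countable_on_bounded_def by blast
qed

lemma countable_on_bounded_reindex:
  assumes h: "countable_on_bounded I h" and card: "|J| =o |I|"
  shows "\<exists>h'. countable_on_bounded J h'"
proof -
  obtain b where b: "bij_betw b J I"
    using card card_of_ordIso by blast
  have "countable {j \<in> J. \<forall>n. h (b j) n \<le> g n}" for g
  proof (rule countable_image_inj_on)
    have "b ` {j \<in> J. \<forall>n. h (b j) n \<le> g n} \<subseteq> {i \<in> I. \<forall>n. h i n \<le> g n}"
      using b by (auto simp: bij_betw_def)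
    then show "countable (b ` {j \<in> J. \<forall>n. h (b j) n \<le> g n})"
      using h countable_subset unfolding countable_on_bounded_def by blast
    show "inj_on b {j \<in> J. \<forall>n. h (b j) n \<le> g n}"
      using b by (auto simp: bij_betw_def inj_on_def)
  qed
  then show ?thesis
    by (intro exI[of _ "\<lambda>j. h (b j)"]) (simp add: countable_on_bounded_def)
qed

section \<open>From a \<open>\<lambda>'\<close>-set to \<open>C8\<close>\<close>

text \<open>
  Points \<open>x t\<close> have infinitely many nonzero digits, and both \<open>h t\<close> and the digits of \<open>t\<close> can be read
  off from their positions. If the inverse \<open>f\<close> of \<open>x\<close> is uniformly continuous on \<open>A\<close>, it extends
  to the closure of \<open>A\<close>, which leaves the range of \<open>cantor_code\<close> at countably many points only.
  The \<open>\<lambda>'\<close>-property, applied to the set \<open>L\<close> of the values there, covers the rest of \<open>A\<close> by countably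
  many compact subsets of the range of \<open>cantor_code\<close>, on each of which \<open>h\<close> is bounded.
\<close>

lemma C8_if_lambda_prime:
  fixes \<nu> :: "'k rel"
  assumes T: "lambda_prime_set_in (top_of_set cantor_set) T"
    and card_T: "|T| =o \<nu>"
    and h: "countable_on_bounded T h"
  shows "C8 \<nu> aleph1"
proof -
  have "T \<subseteq> cantor_set"
    using T by (simp add: lambda_prime_set_in_def)
  then have "\<forall>t\<in>T. \<exists>d. t = cantor_map d"
    by (auto simp: cantor_set_eq)
  from bchoice[OF this] obtain d where d: "\<And>t. t \<in> T \<Longrightarrow> t = cantor_map (d t)"
    by blast
  \<comment> \<open>Every increment of the doubled sum is at least 2, so \<open>r t\<close> stays
    strictly increasing while the parity of \<open>r t n\<close> stores digit \<open>n\<close> of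
    \<open>t\<close>.\<close>
  define r where "r t n = 2 * (\<Sum>i\<le>n. Suc (h t i)) + (if d t n then 1 else 0)" for t n
  have mono_r: "strict_mono (r t)" for t
    unfolding strict_mono_Suc_iff by (simp add: r_def)
  have h_le_r: "h t n \<le> r t n" for t n
    using member_le_sum[of n "{..n}" "\<lambda>i. Suc (h t i)"] by (simp add: r_def)
  have r_digit: "d t n = d t' n" if "r t n = r t' n" for t t' n
    using arg_cong[OF that, of odd] by (auto simp: r_def split: if_splits)
  define x where "x t = cantor_code (r t)" for t
  have close: "\<bar>t - t'\<bar> \<le> 1 / 3 ^ N"
    if "t \<in> T" "t' \<in> T" "\<bar>x t - x t'\<bar> < 1 / 3 ^ Suc (r t N)" for t t' N
  proof -
    have "r t' k = r t k" if "k \<le> N" for k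
      using cantor_code_close[OF mono_r mono_r] \<open>\<bar>x t - x t'\<bar> < _\<close> that by (simp add: x_def)
    then have "\<forall>k<N. d t k = d t' k"
      using r_digit by (metis less_imp_le)
    then show ?thesis
      using cantor_map_close d that(1,2) by metis
  qed
  have inj_x: "inj_on x T"
  proof (rule inj_onI)
    fix t t' assume t: "t \<in> T" "t' \<in> T" "x t = x t'"
    have "r t k = r t' k" for k
      using cantor_code_close[OF mono_r mono_r, of t t' k k] t(3) by (simp add: x_def)
    then have "d t = d t'"
      using r_digit by blast
    then show "t = t'"
      using d t by metis
  qed
  define f where "f = inv_into T x"
  have f_x: "f (x t) = t" if "t \<in> T" for t
    using inj_x that by (simp add: f_def)
  have cont: "continuous_on (x ` T) f"
    unfolding continuous_on_iff
  proof clarify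
    fix t and e :: real assume "t \<in> T" "0 < e"
    obtain N where N: "(1 / 3) ^ N < e"
      using real_arch_pow_inv[OF \<open>0 < e\<close>, of "1/3"] by auto
    have "dist (f (x t')) (f (x t)) < e" if "t' \<in> T" "dist (x t') (x t) < 1 / 3 ^ Suc (r t N)" for t'
    proof -
      have "\<bar>t - t'\<bar> \<le> 1 / 3 ^ N"
        using close[OF \<open>t \<in> T\<close> \<open>t' \<in> T\<close>] that(2) by (simp add: dist_real_def abs_minus_commute)
      then show ?thesis
        using N \<open>t \<in> T\<close> \<open>t' \<in> T\<close> by (simp add: f_x dist_real_def power_one_over abs_minus_commute)
    qed
    then show "\<exists>\<delta>>0. \<forall>y\<in>x ` T. dist y (x t) < \<delta> \<longrightarrow> dist (f y) (f (x t)) < e"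
      by (intro exI[of _ "1 / 3 ^ Suc (r t N)"]) auto
  qed
  have countable_if_uc: "countable A" if A: "A \<subseteq> x ` T" and uc: "uniformly_continuous_on A f" for A
  proof -
    obtain g where g: "uniformly_continuous_on (closure A) g" "\<And>y. y \<in> A \<Longrightarrow> f y = g y"
      using uniformly_continuous_on_extension_on_closure[OF uc] by metis
    have cont_g: "continuous_on (closure A) g"
      using g(1) by (rule uniformly_continuous_imp_continuous)
    have closure_sub: "closure A \<subseteq> cantor_set"
      using A closed_cantor_set by (intro closure_minimal) (auto simp: x_def cantor_code_def cantor_set_eq)
    define Q where "Q = cantor_map ` {d. finite {n. d n}}"
    define L where "L = cantor_set \<inter> g ` (closure A \<inter> Q)"
    have "countable L"
      unfolding L_def Q_def by (intro countable_Int2 countable_image countable_finite_digits)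
    moreover have "L \<subseteq> cantor_set"
      by (auto simp: L_def)
    ultimately have "gdelta_in (top_of_set (T \<union> L)) L"
      using T \<open>T \<subseteq> cantor_set\<close>
      by (auto simp: lambda_prime_set_in_def subtopology_subtopology Int_absorb1)
    then have "fsigma_in (top_of_set (T \<union> L)) (T \<union> L - L)"
      by (simp add: gdelta_in_fsigma_in)
    then obtain B where B: "\<And>n::nat. closedin (top_of_set (T \<union> L)) (B n)" "\<Union> (range B) = T \<union> L - L"
      unfolding fsigma_in_ascending by blast
    then have "\<forall>n. \<exists>F. closed F \<and> B n = (T \<union> L) \<inter> F"
      by (simp add: closedin_closed)
    then obtain F where F: "\<And>n. closed (F n)" "\<And>n. B n = (T \<union> L) \<inter> F n"
      by metis
    \<comment> \<open>\<open>M n\<close> misses \<open>Q\<close>: a point of \<open>Q\<close> in it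
      would have its value in \<open>L\<close> and in \<open>F n\<close>, hence in
      \<open>B n\<close>, which is disjoint from \<open>L\<close>.\<close>
    define M where "M n = closure A \<inter> g -` (F n \<inter> cantor_set)" for n
    have "compact (M n)" for n
    proof -
      have "closed (M n)"
        unfolding M_def
        by (intro continuous_closed_preimage cont_g closed_closure closed_Int F closed_cantor_set)
      then have "compact (cantor_set \<inter> M n)"
        by (rule compact_Int_closed[OF compact_cantor_set])
      moreover have "cantor_set \<inter> M n = M n"
        using closure_sub by (auto simp: M_def)
      ultimately show ?thesis
        by simp
    qed
    moreover have "M n \<subseteq> cantor_map ` {d. infinite {n. d n}}" for n
    proof
      fix z assume z: "z \<in> M n"
      then have "g z \<notin> L"
        using F(2)[of n] B(2) by (auto simp: M_def)
      then have "z \<notin> Q"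
        using z by (auto simp: M_def L_def)
      moreover have "z \<in> cantor_set"
        using z closure_sub by (auto simp: M_def)
      ultimately show "z \<in> cantor_map ` {d. infinite {n. d n}}"
        by (auto simp: Q_def cantor_set_eq)
    qed
    ultimately have "\<exists>m. \<forall>r. strict_mono r \<and> cantor_code r \<in> M k \<longrightarrow> r n \<le> m" for k n
      by (rule compact_code_bounded)
    then obtain G where G: "\<And>k n r. strict_mono r \<Longrightarrow> cantor_code r \<in> M k \<Longrightarrow> r n \<le> G k n"
      by metis
    have "A \<subseteq> x ` L \<union> (\<Union>k. x ` {t \<in> T. \<forall>n. h t n \<le> G k n})"
    proof
      fix y assume "y \<in> A"
      then obtain t where t: "t \<in> T" "y = x t"
        using A by blast
      then have g_y: "g y = t"
        using g(2)[OF \<open>y \<in> A\<close>] by (simp add: f_x)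
      show "y \<in> x ` L \<union> (\<Union>k. x ` {t \<in> T. \<forall>n. h t n \<le> G k n})"
      proof (cases "t \<in> L")
        case True
        then show ?thesis
          using t(2) by blast
      next
        case False
        then obtain k where "t \<in> B k"
          using t(1) B(2) by blast
        then have "y \<in> M k"
          using g_y F(2) \<open>y \<in> A\<close> closure_subset t(1) \<open>T \<subseteq> cantor_set\<close> by (auto simp: M_def)
        then have "h t n \<le> G k n" for n
          using G[OF mono_r] h_le_r le_trans t(2) unfolding x_def by blast
        then show ?thesis
          using t by blast
      qed
    qed
    moreover have "countable (x ` L \<union> (\<Union>k. x ` {t \<in> T. \<forall>n. h t n \<le> G k n}))"
      using \<open>countable L\<close> h by (auto simp: countable_on_bounded_def)
    ultimately show ?thesis
      by (rule countable_subset)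
  qed
  have "|x ` T| =o \<nu>"
    using card_of_ordIso[THEN iffD1, OF exI, OF inj_on_imp_bij_betw[OF inj_x]] card_T
    by (meson ordIso_symmetric ordIso_transitive)
  moreover have "\<not> uniformly_continuous_on A f" if "A \<subseteq> x ` T" "|A| =o aleph1" for A
    using countable_if_uc that uncountable_aleph1 by blast
  ultimately show ?thesis
    unfolding C8_def using cont by blast
qed

section \<open>A Hausdorff gap\<close>

text \<open>\<open>R\<close> is a strict well-order of type omega_1 on \<open>I\<close>. Elements
  outside \<open>I\<close> have no predecessors, so recursions along \<open>R\<close> can run over
  the whole type.\<close>

locale omega_one =
  fixes I :: "'a set" and R :: "'a rel"
  assumes wf_R: "wf R" and trans_R: "trans R" and R_sub: "R \<subseteq> I \<times> I"
    and total_R: "\<And>a b. a \<in> I \<Longrightarrow> b \<in> I \<Longrightarrow> a = b \<or> (a, b) \<in> R \<or> (b, a) \<in> R"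
    and countable_segment: "\<And>a. countable {b. (b, a) \<in> R}"
    and uncountable_I: "uncountable I"
begin

text \<open>The downward closure of a countable set is countable, so some element of
  \<open>A\<close> lies outside it and, by totality, above it.\<close>

lemma upper_bound:
  assumes "A \<subseteq> I" "uncountable A" "L \<subseteq> I" "countable L"
  shows "\<exists>a\<in>A. \<forall>l\<in>L. (l, a) \<in> R"
proof -
  define U where "U = (\<Union>l\<in>L. insert l {b. (b, l) \<in> R})"
  have "countable U"
    unfolding U_def using assms(4) countable_segment by (intro countable_UN countable_insert)
  then have "\<not> A \<subseteq> U"
    using assms(2) countable_subset by blast
  then obtain a where a: "a \<in> A" "a \<notin> U"
    by blast
  have "(l, a) \<in> R" if "l \<in> L" for l
    using total_R[of a l] a that assms(1,3) by (auto simp: U_def)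
  then show ?thesis
    using a(1) by blast
qed

end

text \<open>Diagonal argument: \<open>g n\<close> exceeds the values at \<open>n\<close> of the
  functions numbered \<open>0\<close> to \<open>n\<close>, so the function numbered \<open>i\<close>
  is beaten from \<open>i\<close> on.\<close>

lemma countable_eventually_less:
  fixes F :: "(nat \<Rightarrow> nat) set"
  assumes "countable F"
  shows "\<exists>g. \<forall>f\<in>F. \<forall>\<^sub>F n in sequentially. f n < g n"
proof (cases "F = {}")
  case False
  define g where "g n = Suc (Max ((\<lambda>i. from_nat_into F i n) ` {..n}))" for n
  have "\<forall>\<^sub>F n in sequentially. f n < g n" if "f \<in> F" for f
  proof -
    obtain i where i: "f = from_nat_into F i"
      using from_nat_into_surj[OF assms \<open>f \<in> F\<close>] by metis
    have "f n < g n" if "i \<le> n" for n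
      using that unfolding g_def i by (auto simp: less_Suc_eq_le intro!: Max_ge)
    then show ?thesis
      unfolding eventually_sequentially by blast
  qed
  then show ?thesis
    by blast
qed simp

context omega_one
begin

text \<open>Each stage has countably many predecessors, so \<open>countable_eventually_less\<close>
  drives the recursion. The increase yields towers; domination of \<open>u\<close> carries
  unboundedness of a given family over to the chain.\<close>

lemma chain_exists:
  fixes u :: "'a \<Rightarrow> nat \<Rightarrow> nat"
  shows "\<exists>f. \<forall>a. (\<forall>b. (b, a) \<in> R \<longrightarrow> (\<forall>\<^sub>F n in sequentially. f b n < f a n)) \<and>
    (\<forall>\<^sub>F n in sequentially. u a n < f a n)"
proof (rule dependent_wf_choice[OF wf_R])
  fix f :: "'a \<Rightarrow> nat \<Rightarrow> nat" and a
  have "countable (insert (u a) (f ` {b. (b, a) \<in> R}))"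
    using countable_segment by simp
  from countable_eventually_less[OF this]
  show "\<exists>r. (\<forall>b. (b, a) \<in> R \<longrightarrow> (\<forall>\<^sub>F n in sequentially. f b n < r n)) \<and>
      (\<forall>\<^sub>F n in sequentially. u a n < r n)"
    by blast
qed auto

end

text \<open>The sets \<open>g a\<close> are kept out of the gap, so that later stages can pick new points there.\<close>

locale tower = omega_one +
  fixes c g :: "'a \<Rightarrow> nat set"
  assumes g_sub: "\<And>a. g a \<subseteq> c a"
    and infinite_g: "\<And>a. infinite (g a)"
    and tower: "\<And>a b. (b, a) \<in> R \<Longrightarrow> finite (c b - (c a - g a))"
begin

text \<open>
  The last conjunct is Hausdorff's condition: it prevents a set from separating the \<open>A b\<close>
  from the \<open>c b - A b\<close> modulo finite sets.
\<close>

definition coherent :: "('a \<Rightarrow> nat set) \<Rightarrow> 'a \<Rightarrow> nat set \<Rightarrow> bool"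
  where "coherent A a X \<longleftrightarrow> X \<subseteq> c a - g a \<and>
    (\<forall>b. (b, a) \<in> R \<longrightarrow> finite {x \<in> c b. (x \<in> X) \<noteq> (x \<in> A b)}) \<and>
    (\<forall>n. finite {b. (b, a) \<in> R \<and> X \<inter> (c b - A b) \<subseteq> {..<n}})"

lemma tower': "(b, a) \<in> R \<Longrightarrow> finite (c b - c a)"
  by (rule finite_subset[OF _ tower[of b a]]) blast+

lemma finite_g_Int:
  assumes "(b, a) \<in> R"
  shows "finite (g a \<inter> c b)"
  by (rule finite_subset[OF _ tower[OF assms]]) blast

text \<open>
  Along a cofinal sequence \<open>s\<close>, the set \<open>X\<^sub>1\<close> glues the sets \<open>A (s i)\<close>. It may violate Hausdorff's
  condition, but only through infinitely many \<open>b\<close> which are cofinal; each of these is repaired by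
  one additional point \<open>y b\<close>, chosen outside \<open>c (s j)\<close> for all \<open>s j\<close> below \<open>b\<close> so that coherence is kept.
\<close>

lemma coherent_step:
  assumes IH: "\<And>b. (b, a) \<in> R \<Longrightarrow> coherent A b (A b)"
  shows "\<exists>X. coherent A a X"
proof (cases "{b. (b, a) \<in> R} = {}")
  case True
  then have "coherent A a {}"
    unfolding coherent_def by auto
  then show ?thesis ..
next
  case False
  define J where "J = {b. (b, a) \<in> R}"
  define le where "le b b' \<longleftrightarrow> b = b' \<or> (b, b') \<in> R" for b b'
  have J_sub: "J \<subseteq> I"
    using R_sub by (auto simp: J_def)
  have le_trans: "le b b''" if "le b b'" "le b' b''" for b b' b''
    using that trans_R unfolding le_def by (blast dest: transD)
  have A_sub: "A b \<subseteq> c b - g b" if "b \<in> J" for b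
    using IH that by (simp add: J_def coherent_def)
  have A_coh: "finite {x \<in> c b \<inter> c b'. (x \<in> A b') \<noteq> (x \<in> A b)}" if "b' \<in> J" "le b b'" for b b'
  proof (cases "b = b'")
    case False
    then have "finite {x \<in> c b. (x \<in> A b') \<noteq> (x \<in> A b)}"
      using that IH by (simp add: J_def coherent_def le_def)
    then show ?thesis
      by (rule finite_subset[rotated]) blast
  qed simp
  have A_hit: "finite {b'. (b', b) \<in> R \<and> A b \<inter> (c b' - A b') \<subseteq> {..<n}}" if "b \<in> J" for b n
    using that IH by (simp add: J_def coherent_def)
  have c_le: "finite (c b - c b')" if "le b b'" for b b'
    using that tower' by (auto simp: le_def)

  define e where "e = from_nat_into J"
  have e_in: "e i \<in> J" for i
    using from_nat_into[OF False] by (simp add: e_def J_def)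
  \<comment> \<open>\<open>s\<close> moves to the next term of the enumeration \<open>e\<close>
    whenever that is larger and otherwise stays. Repetitions also cover the case of a largest
    element of \<open>J\<close>.\<close>
  define s where "s = rec_nat (e 0) (\<lambda>i b. if le b (e (Suc i)) then e (Suc i) else b)"
  have s_0: "s 0 = e 0" and s_Suc: "s (Suc i) = (if le (s i) (e (Suc i)) then e (Suc i) else s i)" for i
    by (simp_all add: s_def)
  have s_in: "s i \<in> J" for i
    by (induction i) (auto simp: s_0 s_Suc e_in)
  have s_mono: "le (s i) (s j)" if "i \<le> j" for i j
    using that
  proof (induction rule: dec_induct)
    case (step j)
    then show ?case
      using le_trans by (auto simp: s_Suc)
  qed (simp add: le_def)
  have e_le_s: "le (e i) (s i)" for i
  proof (cases i)
    case (Suc j)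
    then show ?thesis
      using total_R[of "s j" "e i"] s_in[of j] e_in[of i] J_sub by (auto simp: s_Suc le_def)
  qed (simp add: s_0 le_def)
  have cofinal: "\<exists>i. le b (s i)" if "b \<in> J" for b
    using from_nat_into_surj[of J b] that countable_segment e_le_s by (metis J_def e_def)

  \<comment> \<open>All \<open>s j\<close> with \<open>j < k b\<close> lie strictly below
    \<open>b\<close>, so \<open>g b\<close> is almost disjoint from each
    \<open>c (s j)\<close>.\<close>
  define k where "k b = (LEAST i. le b (s i))" for b
  have le_k: "le b (s (k b))" if "b \<in> J" for b
    using LeastI_ex[OF cofinal[OF that]] by (simp add: k_def)
  have less_k: "(s j, b) \<in> R" if "b \<in> J" "j < k b" for b j
    using not_less_Least[of j "\<lambda>i. le b (s i)"] that total_R[of "s j" b] s_in[of j] J_sub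
    by (auto simp: k_def le_def)

  \<comment> \<open>Each point follows \<open>A (s i)\<close> for the first \<open>i\<close> with
    the point in \<open>c (s i)\<close>. Thus a disagreement with a later \<open>A (s i)\<close> is
    one between two sets \<open>A (s j)\<close> and \<open>A (s i)\<close>.\<close>
  define X\<^sub>0 where "X\<^sub>0 = {x. \<exists>i. x \<in> c (s i) \<and> (\<forall>j<i. x \<notin> c (s j)) \<and> x \<in> A (s i)}"
  have X\<^sub>0_coh: "finite {x \<in> c (s i). (x \<in> X\<^sub>0) \<noteq> (x \<in> A (s i))}" for i
  proof -
    have "{x \<in> c (s i). (x \<in> X\<^sub>0) \<noteq> (x \<in> A (s i))}
        \<subseteq> (\<Union>j\<le>i. {x \<in> c (s j) \<inter> c (s i). (x \<in> A (s i)) \<noteq> (x \<in> A (s j))})"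
    proof
      fix x assume x: "x \<in> {x \<in> c (s i). (x \<in> X\<^sub>0) \<noteq> (x \<in> A (s i))}"
      define j where "j = (LEAST j. x \<in> c (s j))"
      have j: "x \<in> c (s j)" "j \<le> i"
        using x LeastI[of "\<lambda>j. x \<in> c (s j)" i] Least_le[of "\<lambda>j. x \<in> c (s j)" i] by (auto simp: j_def)
      have first: "\<forall>j'<j. x \<notin> c (s j')"
        using not_less_Least unfolding j_def by blast
      have "x \<in> X\<^sub>0 \<longleftrightarrow> x \<in> A (s j)"
      proof
        assume "x \<in> X\<^sub>0"
        then obtain i' where i': "x \<in> c (s i')" "\<forall>j<i'. x \<notin> c (s j)" "x \<in> A (s i')"
          unfolding X\<^sub>0_def by blast
        then have "i' = j"
          using j(1) first by (metis linorder_neqE_nat)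
        then show "x \<in> A (s j)"
          using i' by simp
      qed (use j first in \<open>auto simp: X\<^sub>0_def\<close>)
      then show "x \<in> (\<Union>j\<le>i. {x \<in> c (s j) \<inter> c (s i). (x \<in> A (s i)) \<noteq> (x \<in> A (s j))})"
        using x j by blast
    qed
    moreover have "finite (\<Union>j\<le>i. {x \<in> c (s j) \<inter> c (s i). (x \<in> A (s i)) \<noteq> (x \<in> A (s j))})"
      using A_coh s_in s_mono by (intro finite_UN_I) auto
    ultimately show ?thesis
      by (rule finite_subset)
  qed

  define X\<^sub>1 where "X\<^sub>1 = X\<^sub>0 \<inter> (c a - g a)"
  have X\<^sub>1_coh: "finite {x \<in> c b. (x \<in> X\<^sub>1) \<noteq> (x \<in> A b)}" if "b \<in> J" for b
  proof -
    obtain i where i: "le b (s i)"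
      using cofinal[OF \<open>b \<in> J\<close>] by blast
    have "{x \<in> c b. (x \<in> X\<^sub>1) \<noteq> (x \<in> A b)} \<subseteq> (c b - (c a - g a)) \<union> (c b - c (s i)) \<union>
        {x \<in> c (s i). (x \<in> X\<^sub>0) \<noteq> (x \<in> A (s i))} \<union> {x \<in> c b \<inter> c (s i). (x \<in> A (s i)) \<noteq> (x \<in> A b)}"
      by (auto simp: X\<^sub>1_def)
    moreover have "finite \<dots>"
      using tower[of b a] that c_le[OF i] X\<^sub>0_coh A_coh[OF s_in i] by (auto simp: J_def)
    ultimately show ?thesis
      by (rule finite_subset)
  qed
  \<comment> \<open>Below a single \<open>b\<close> Hausdorff's condition is inherited from
    \<open>A b\<close>, because \<open>X\<^sub>1\<close> and \<open>A b\<close> agree on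
    \<open>c b\<close> from some \<open>m\<close> on. It can fail only for \<open>J\<close> as a
    whole.\<close>
  have X\<^sub>1_hit: "finite {b'. le b' b \<and> X\<^sub>1 \<inter> (c b' - A b') \<subseteq> {..<n}}" if "b \<in> J" for b n
  proof -
    obtain m where m: "{x \<in> c b. (x \<in> X\<^sub>1) \<noteq> (x \<in> A b)} \<subseteq> {..<m}"
      using finite_nat_bounded[OF X\<^sub>1_coh[OF \<open>b \<in> J\<close>]] by blast
    have "{b'. le b' b \<and> X\<^sub>1 \<inter> (c b' - A b') \<subseteq> {..<n}}
        \<subseteq> insert b {b'. (b', b) \<in> R \<and> A b \<inter> (c b' - A b') \<subseteq> {..<max n m}}"
    proof clarify
      fix b' x assume *: "le b' b" "X\<^sub>1 \<inter> (c b' - A b') \<subseteq> {..<n}" "b' \<noteq> b"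
      have "x < max n m" if "x \<in> A b" "x \<in> c b'" "x \<notin> A b'" for x
      proof (cases "x \<in> X\<^sub>1")
        case True
        then show ?thesis
          using * that by force
      next
        case False
        then have "x < m"
          using m A_sub[OF \<open>b \<in> J\<close>] that by blast
        then show ?thesis
          by simp
      qed
      then show "(b', b) \<in> R \<and> A b \<inter> (c b' - A b') \<subseteq> {..<max n m}"
        using * by (auto simp: le_def)
    qed
    then show ?thesis
      using A_hit[OF that] finite_subset by blast
  qed

  define B where "B = {b \<in> J. X\<^sub>1 \<inter> (c b - A b) \<subseteq> {..<k b}}"
  have finite_B: "finite {b \<in> B. k b \<le> n}" for n
  proof -
    have "{b \<in> B. k b \<le> n} \<subseteq> (\<Union>i\<le>n. {b. le b (s i) \<and> X\<^sub>1 \<inter> (c b - A b) \<subseteq> {..<n}})"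
    proof
      fix b assume b: "b \<in> {b \<in> B. k b \<le> n}"
      then have "le b (s (k b))" "X\<^sub>1 \<inter> (c b - A b) \<subseteq> {..<n}"
        using le_k by (auto simp: B_def)
      then show "b \<in> (\<Union>i\<le>n. {b. le b (s i) \<and> X\<^sub>1 \<inter> (c b - A b) \<subseteq> {..<n}})"
        using b by blast
    qed
    then show ?thesis
      using X\<^sub>1_hit s_in by (auto intro: finite_subset)
  qed
  \<comment> \<open>The infinite set \<open>g b\<close> is almost contained in
    \<open>c a - g a\<close> and almost disjoint from the finitely many \<open>c (s j)\<close>, so
    suitable points remain. A point of \<open>g b\<close> lies in \<open>c b\<close> but not in
    \<open>A b\<close>, as the repair requires.\<close>
  have "\<forall>b\<in>J. \<exists>y. y \<in> g b \<inter> (c a - g a) \<and> (\<forall>j<k b. y \<notin> c (s j)) \<and> k b \<le> y"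
  proof
    fix b assume b: "b \<in> J"
    have "g b - (c a - g a) \<subseteq> c b - (c a - g a)"
      using g_sub by blast
    then have "finite (g b - (c a - g a))"
      using tower[of b a] b finite_subset by (auto simp: J_def)
    moreover have "finite (\<Union>j<k b. g b \<inter> c (s j))"
      using less_k[OF b] finite_g_Int by (intro finite_UN_I) simp_all
    ultimately have "infinite (g b - (g b - (c a - g a)) - (\<Union>j<k b. g b \<inter> c (s j)) - {..<k b})"
      using infinite_g[of b] by (intro Diff_infinite_finite) simp_all
    from infinite_imp_nonempty[OF this]
    obtain y where "y \<in> g b - (g b - (c a - g a)) - (\<Union>j<k b. g b \<inter> c (s j)) - {..<k b}"
      by (auto simp del: UN_iff)
    then show "\<exists>y. y \<in> g b \<inter> (c a - g a) \<and> (\<forall>j<k b. y \<notin> c (s j)) \<and> k b \<le> y"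
      by (intro exI[of _ y]) auto
  qed
  from bchoice[OF this] obtain y where y: "\<And>b. b \<in> J \<Longrightarrow> y b \<in> g b \<inter> (c a - g a)"
    "\<And>b j. b \<in> J \<Longrightarrow> j < k b \<Longrightarrow> y b \<notin> c (s j)" "\<And>b. b \<in> J \<Longrightarrow> k b \<le> y b"
    by blast
  define X where "X = X\<^sub>1 \<union> y ` B"
  have y_coh: "finite (y ` B \<inter> c b)" if "b \<in> J" for b
  proof -
    have "y ` B \<inter> c (s (k b)) \<subseteq> y ` {b' \<in> B. k b' \<le> k b}"
      using y(2) by (force simp: B_def linorder_not_less)
    then have "finite (y ` B \<inter> c (s (k b)))"
      using finite_B finite_subset by blast
    moreover have "y ` B \<inter> c b \<subseteq> (y ` B \<inter> c (s (k b))) \<union> (c b - c (s (k b)))"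
      by blast
    ultimately show ?thesis
      using c_le[OF le_k[OF that]] by (meson finite_UnI finite_subset)
  qed
  have "coherent A a X"
    unfolding coherent_def
  proof (intro conjI allI impI)
    show "X \<subseteq> c a - g a"
      using y(1) by (auto simp: X_def X\<^sub>1_def B_def)
    show "finite {x \<in> c b. (x \<in> X) \<noteq> (x \<in> A b)}" if "(b, a) \<in> R" for b
    proof (rule finite_subset)
      show "{x \<in> c b. (x \<in> X) \<noteq> (x \<in> A b)} \<subseteq> {x \<in> c b. (x \<in> X\<^sub>1) \<noteq> (x \<in> A b)} \<union> (y ` B \<inter> c b)"
        by (auto simp: X_def)
      show "finite ({x \<in> c b. (x \<in> X\<^sub>1) \<noteq> (x \<in> A b)} \<union> (y ` B \<inter> c b))"
        using X\<^sub>1_coh y_coh that by (simp add: J_def)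
    qed
    show "finite {b. (b, a) \<in> R \<and> X \<inter> (c b - A b) \<subseteq> {..<n}}" for n
    proof (rule finite_subset)
      show "{b. (b, a) \<in> R \<and> X \<inter> (c b - A b) \<subseteq> {..<n}} \<subseteq>
        (\<Union>i\<le>n. {b. le b (s i) \<and> X\<^sub>1 \<inter> (c b - A b) \<subseteq> {..<n}})"
      proof
        fix b assume "b \<in> {b. (b, a) \<in> R \<and> X \<inter> (c b - A b) \<subseteq> {..<n}}"
        then have b: "b \<in> J" "X \<inter> (c b - A b) \<subseteq> {..<n}"
          by (auto simp: J_def)
        \<comment> \<open>Otherwise \<open>b\<close> belongs to \<open>B\<close>, and its added
          point \<open>y b\<close> is at least \<open>k b\<close>, hence not below
          \<open>n\<close>.\<close>
        have "k b \<le> n"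
        proof (rule ccontr)
          assume "\<not> k b \<le> n"
          then have "X\<^sub>1 \<inter> (c b - A b) \<subseteq> {..<k b}"
            using b(2) unfolding X_def by force
          then have "b \<in> B"
            using b(1) by (simp add: B_def)
          moreover have "y b \<in> c b - A b"
            using y(1)[OF b(1)] g_sub A_sub[OF b(1)] by blast
          ultimately have "y b < n"
            using b(2) unfolding X_def by blast
          then show False
            using y(3)[OF b(1)] \<open>\<not> k b \<le> n\<close> by simp
        qed
        then show "b \<in> (\<Union>i\<le>n. {b. le b (s i) \<and> X\<^sub>1 \<inter> (c b - A b) \<subseteq> {..<n}})"
          using le_k[OF b(1)] b(2) unfolding X_def by blast
      qed
      show "finite (\<Union>i\<le>n. {b. le b (s i) \<and> X\<^sub>1 \<inter> (c b - A b) \<subseteq> {..<n}})"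
        using X\<^sub>1_hit s_in by blast
    qed
  qed
  then show ?thesis ..
qed

lemma gap_exists: "\<exists>A. \<forall>a. coherent A a (A a)"
proof (rule dependent_wf_choice[OF wf_R])
  show "coherent A a X = coherent A' a X" if "\<And>b. (b, a) \<in> R \<Longrightarrow> A b = A' b" for A A' a X
    using that unfolding coherent_def by (intro arg_cong2[of _ _ _ _ "(\<and>)"] refl all_cong1 arg_cong[of _ _ finite]) auto
qed (rule coherent_step)

text \<open>Beyond some \<open>n a\<close> the set \<open>Y\<close> agrees with \<open>A a\<close>
  on \<open>c a\<close>, and \<open>n a\<close> has one value \<open>m\<close> for uncountably many
  \<open>a\<close>. Infinitely many of these lie below another one, \<open>a\<close>; for each such
  \<open>l\<close>, \<open>A a\<close> meets \<open>c l - A l\<close> only below \<open>m\<close>,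
  against Hausdorff's condition.\<close>

lemma gap_not_separated:
  assumes A: "\<And>a. coherent A a (A a)" and Y: "\<And>a. a \<in> I \<Longrightarrow> finite {x \<in> c a. (x \<in> Y) \<noteq> (x \<in> A a)}"
  shows False
proof -
  have "\<forall>a\<in>I. \<exists>n. {x \<in> c a. (x \<in> Y) \<noteq> (x \<in> A a)} \<subseteq> {..<n}"
    using Y finite_nat_bounded by blast
  from bchoice[OF this] obtain n where n: "\<And>a. a \<in> I \<Longrightarrow> {x \<in> c a. (x \<in> Y) \<noteq> (x \<in> A a)} \<subseteq> {..<n a}"
    by blast
  have "\<exists>m. uncountable {a \<in> I. n a = m}"
  proof (rule ccontr)
    assume "\<not> ?thesis"
    then have "countable (\<Union>m. {a \<in> I. n a = m})"
      by (intro countable_UN) auto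
    moreover have "(\<Union>m. {a \<in> I. n a = m}) = I"
      by blast
    ultimately show False
      using uncountable_I by simp
  qed
  then obtain m where m: "uncountable {a \<in> I. n a = m}"
    by blast
  from infinite_countable_subset'[OF uncountable_infinite[OF m]]
  obtain L where L: "L \<subseteq> {a \<in> I. n a = m}" "countable L" "infinite L"
    by blast
  have "\<exists>a\<in>{a \<in> I. n a = m}. \<forall>l\<in>L. (l, a) \<in> R"
    using L by (intro upper_bound[OF _ m]) auto
  then obtain a where a: "a \<in> I" "n a = m" "\<forall>l\<in>L. (l, a) \<in> R"
    by blast
  have "L \<subseteq> {b. (b, a) \<in> R \<and> A a \<inter> (c b - A b) \<subseteq> {..<m}}"
  proof (intro subsetI CollectI conjI)
    fix l x assume l: "l \<in> L"
    then show "(l, a) \<in> R"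
      using a(3) by blast
    assume x: "x \<in> A a \<inter> (c l - A l)"
    then have "x \<in> c a"
      using A[of a] by (auto simp: coherent_def)
    moreover have "l \<in> I" "n l = m"
      using l L(1) by auto
    ultimately show "x \<in> {..<m}"
      using subsetD[OF n[of a], of x] subsetD[OF n[of l], of x] a(1,2) x by (cases "x \<in> Y") auto
  qed
  moreover have "finite {b. (b, a) \<in> R \<and> A a \<inter> (c b - A b) \<subseteq> {..<m}}"
    using A[of a] by (simp add: coherent_def)
  ultimately show False
    using L(3) finite_subset by metis
qed

end

lemma omega_one_aleph1: "omega_one (Field aleph1) (aleph1 - Id)"
proof
  have wo: "well_order_on (Field aleph1) aleph1"
    using Card_order_aleph1 by (simp add: card_order_on_def)
  then have lin: "linear_order_on (Field aleph1) aleph1"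
    by (simp add: well_order_on_def)
  show "wf (aleph1 - Id)"
    using wo by (simp add: well_order_on_def)
  show "trans (aleph1 - Id)"
    using lin by (intro trans_diff_Id) (auto simp: order_on_defs)
  show "aleph1 - Id \<subseteq> Field aleph1 \<times> Field aleph1"
    by (auto intro: FieldI1 FieldI2)
  show "a = b \<or> (a, b) \<in> aleph1 - Id \<or> (b, a) \<in> aleph1 - Id" if "a \<in> Field aleph1" "b \<in> Field aleph1" for a b
    using lin that by (auto simp: order_on_defs total_on_def)
  show "uncountable (Field aleph1)"
    by (rule uncountable_aleph1[OF card_of_Field_aleph1])
  show "countable {b. (b, a) \<in> aleph1 - Id}" for a
  proof (cases "a \<in> Field aleph1")
    case True
    then have "|underS aleph1 a| <o aleph1"
      by (rule card_of_underS[OF Card_order_aleph1])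
    then have "|underS aleph1 a| \<le>o natLeq"
      using cardSuc_ordLeq_ordLess[OF natLeq_Card_order card_of_Card_order] by blast
    moreover have "{b. (b, a) \<in> aleph1 - Id} = underS aleph1 a"
      by (auto simp: underS_def)
    ultimately show ?thesis
      by (simp add: countable_card_le_natLeq)
  next
    case False
    then have "{b. (b, a) \<in> aleph1 - Id} = {}"
      by (auto intro: FieldI2)
    then show ?thesis
      by (metis countable_empty)
  qed
qed

text \<open>\<open>c a\<close> codes the region on and under the graph of \<open>f a\<close>, and
  \<open>g a\<close> the graph. If \<open>f b < f a\<close> eventually, then \<open>c b\<close>
  leaves the region strictly under \<open>f a\<close> only in finitely many columns, each of them
  finite.\<close>

lemma (in omega_one) tower_exists: "\<exists>c g. tower I R c g"
proof -
  obtain f :: "'a \<Rightarrow> nat \<Rightarrow> nat" where f: "\<And>a b. (b, a) \<in> R \<Longrightarrow> \<forall>\<^sub>F n in sequentially. f b n < f a n"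
    using chain_exists by blast
  define c where "c a = prod_encode ` {(n, m). m \<le> f a n}" for a
  define g where "g a = prod_encode ` {(n, m). m = f a n}" for a
  have "tower I R c g"
  proof unfold_locales
    show "g a \<subseteq> c a" for a
      by (auto simp: c_def g_def)
    show "infinite (g a)" for a
    proof
      assume "finite (g a)"
      then have "finite {(n, m). m = f a n}"
        unfolding g_def by (rule finite_imageD) (rule inj_prod_encode)
      then have "finite (fst ` {(n, m). m = f a n})"
        by (rule finite_imageI)
      moreover have "fst ` {(n, m). m = f a n} = UNIV"
        by force
      ultimately show False
        by simp
    qed
    show "finite (c b - (c a - g a))" if "(b, a) \<in> R" for a b
    proof -
      obtain N where N: "\<And>n. N \<le> n \<Longrightarrow> f b n < f a n"
        using f[OF \<open>(b, a) \<in> R\<close>] unfolding eventually_sequentially by blast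
      have "c a - g a = prod_encode ` {(n, m). m < f a n}"
        unfolding c_def g_def image_set_diff[OF inj_prod_encode, symmetric] by (rule arg_cong[of _ _ "image _"]) auto
      then have "c b - (c a - g a) = prod_encode ` ({(n, m). m \<le> f b n} - {(n, m). m < f a n})"
        unfolding c_def image_set_diff[OF inj_prod_encode] by simp
      moreover have "{(n, m). m \<le> f b n} - {(n, m). m < f a n} \<subseteq> (SIGMA n:{..<N}. {..f b n})"
        using N by (force simp: not_le[symmetric])
      then have "finite ({(n, m). m \<le> f b n} - {(n, m). m < f a n})"
        by (rule finite_subset) auto
      ultimately show ?thesis
        by simp
    qed
  qed
  then show ?thesis
    by blast
qed

section \<open>A \<open>\<lambda>'\<close>-set of cardinality \<open>\<aleph>\<^sub>1\<close>\<close>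

lemma fsigma_in_countable:
  fixes S :: "'b::t1_space set"
  assumes "countable S"
  shows "fsigma_in euclidean S"
proof -
  have "fsigma_in euclidean (\<Union> ((\<lambda>x. {x}) ` S))"
    using assms by (intro fsigma_in_Union) (auto intro!: closed_imp_fsigma_in)
  then show ?thesis
    by simp
qed

text \<open>Single digits are locally constant on the Cantor set, so prescribing any set of them is
  a closed condition.\<close>

lemma closed_cantor_digits: "closed (cantor_map ` {d. \<forall>x\<in>S. d x = e x})"
proof -
  have "z \<in> cantor_map ` {d. \<forall>x\<in>S. d x = e x}" if z: "z \<in> closure (cantor_map ` {d. \<forall>x\<in>S. d x = e x})" for z
  proof -
    have "closure (cantor_map ` {d. \<forall>x\<in>S. d x = e x}) \<subseteq> cantor_set"
      by (intro closure_minimal closed_cantor_set) (auto simp: cantor_set_eq)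
    then obtain d where d: "z = cantor_map d"
      using z by (auto simp: cantor_set_eq)
    have "d x = e x" if "x \<in> S" for x
    proof -
      obtain d' where d': "\<forall>x\<in>S. d' x = e x" "dist (cantor_map d') z < 1 / 3 ^ Suc x"
        using z[unfolded closure_approachable, rule_format, of "1 / 3 ^ Suc x"] by auto
      then have "d' x = d x"
        using cantor_map_agree[of d' d "Suc x" x] by (simp add: d dist_real_def)
      then show ?thesis
        using d'(1) that by simp
    qed
    then show ?thesis
      using d by blast
  qed
  then show ?thesis
    by (rule closure_subset_eq[THEN iffD1, OF subsetI])
qed

context tower
begin

text \<open>\<open>F a\<close> consists of the points whose digits agree with \<open>A a\<close> on
  \<open>c a\<close> up to finitely many places. A countable \<open>L\<close> misses some
  \<open>F a\<close>, which contains all but countably many of the chosen points; so the complement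
  of \<open>L\<close> is relatively F-sigma.\<close>

lemma lambda_prime_set_exists:
  "\<exists>T. lambda_prime_set_in (top_of_set cantor_set) T \<and> uncountable T \<and> |T| \<le>o |I|"
proof -
  obtain A where A: "\<And>a. coherent A a (A a)"
    using gap_exists by blast
  define t where "t a = cantor_map (\<lambda>x. x \<in> A a)" for a
  define F where "F a = cantor_map ` {d. finite {x \<in> c a. d x \<noteq> (x \<in> A a)}}" for a
  have t_F: "t a \<in> F a" for a
    by (auto simp: t_def F_def)
  have F_mono: "F a \<subseteq> F b" if "(b, a) \<in> R" for a b
  proof -
    have "finite {x \<in> c b. d x \<noteq> (x \<in> A b)}" if d: "finite {x \<in> c a. d x \<noteq> (x \<in> A a)}" for d
    proof (rule finite_subset)
      show "{x \<in> c b. d x \<noteq> (x \<in> A b)} \<subseteq> {x \<in> c a. d x \<noteq> (x \<in> A a)} \<union> (c b - c a) \<union>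
          {x \<in> c b. (x \<in> A a) \<noteq> (x \<in> A b)}"
        by auto
      show "finite ({x \<in> c a. d x \<noteq> (x \<in> A a)} \<union> (c b - c a) \<union> {x \<in> c b. (x \<in> A a) \<noteq> (x \<in> A b)})"
        using d tower'[OF \<open>(b, a) \<in> R\<close>] A[of a] \<open>(b, a) \<in> R\<close> by (simp add: coherent_def)
    qed
    then show ?thesis
      by (auto simp: F_def)
  qed
  have F_fsigma: "fsigma_in euclidean (F a)" for a
  proof -
    have F_eq: "F a = (\<Union>n. cantor_map ` {d. \<forall>x\<in>c a \<inter> {n..}. d x = (x \<in> A a)})"
    proof -
      have "finite {x \<in> c a. d x \<noteq> (x \<in> A a)} \<longleftrightarrow> (\<exists>n. \<forall>x\<in>c a \<inter> {n..}. d x = (x \<in> A a))" for d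
        unfolding finite_nat_iff_bounded by (auto simp: subset_iff not_le[symmetric])
      then have "{d. finite {x \<in> c a. d x \<noteq> (x \<in> A a)}} = (\<Union>n. {d. \<forall>x\<in>c a \<inter> {n..}. d x = (x \<in> A a)})"
        by blast
      then show ?thesis
        unfolding F_def by (simp only: image_UN)
    qed
    have "fsigma_in euclidean (cantor_map ` {d. \<forall>x\<in>c a \<inter> {n..}. d x = (x \<in> A a)})" for n
      by (rule closed_imp_fsigma_in) (simp only: closed_closedin[symmetric] closed_cantor_digits)
    then show ?thesis
      unfolding F_eq by (intro fsigma_in_Union) auto
  qed
  \<comment> \<open>The digit set of a point common to all \<open>F a\<close> would separate the
    gap.\<close>
  have F_Int: "\<exists>a\<in>I. x \<notin> F a" for x
  proof (rule ccontr)
    assume *: "\<not> ?thesis"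
    have "I \<noteq> {}"
      using uncountable_I by auto
    then obtain a where "a \<in> I"
      by blast
    then obtain d where d: "x = cantor_map d"
      using * by (auto simp: F_def)
    have "finite {x \<in> c a. (x \<in> Collect d) \<noteq> (x \<in> A a)}" if "a \<in> I" for a
    proof -
      have "cantor_map d \<in> F a"
        using * that d by blast
      then show ?thesis
        unfolding F_def inj_image_mem_iff[OF inj_cantor_map] by simp
    qed
    then show False
      by (rule gap_not_separated[OF A])
  qed
  have F_avoid: "\<exists>a\<in>I. L \<inter> F a = {}" if "countable L" for L
  proof -
    obtain \<alpha> where \<alpha>: "\<And>x. \<alpha> x \<in> I" "\<And>x. x \<notin> F (\<alpha> x)"
      using F_Int by metis
    have "\<exists>a\<in>I. \<forall>l\<in>\<alpha> ` L. (l, a) \<in> R"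
      using \<alpha>(1) uncountable_I that by (intro upper_bound) auto
    then obtain a where "a \<in> I" "\<And>x. x \<in> L \<Longrightarrow> (\<alpha> x, a) \<in> R"
      by blast
    then show ?thesis
      using F_mono \<alpha>(2) by blast
  qed
  \<comment> \<open>If the set of chosen points were countable, it would miss some
    \<open>F a\<close>, although \<open>t a\<close> lies in \<open>F a\<close>.\<close>
  have "uncountable (t ` I)"
  proof
    assume "countable (t ` I)"
    from F_avoid[OF this] show False
      using t_F by blast
  qed
  moreover have "lambda_prime_set_in (top_of_set cantor_set) (t ` I)"
    unfolding lambda_prime_set_in_def
  proof (intro conjI allI impI)
    show T_sub: "t ` I \<subseteq> topspace (top_of_set cantor_set)"
      by (auto simp: t_def cantor_set_eq)
    fix L assume L: "L \<subseteq> topspace (top_of_set cantor_set) \<and> countable L"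
    then obtain a where a: "a \<in> I" "L \<inter> F a = {}"
      using F_avoid by blast
    have "t ` I - F a \<subseteq> t ` {b. (b, a) \<in> R}"
    proof
      fix z assume "z \<in> t ` I - F a"
      then obtain b where b: "b \<in> I" "z = t b" "t b \<notin> F a"
        by blast
      then have "b \<noteq> a" "(a, b) \<notin> R"
        using t_F F_mono by blast+
      then show "z \<in> t ` {b. (b, a) \<in> R}"
        using total_R[OF a(1) b(1)] b(2) by blast
    qed
    then have "countable (t ` I - F a)"
      using countable_segment countable_image countable_subset by metis
    then have "fsigma_in euclidean (F a \<union> (t ` I - F a - L))"
      by (intro fsigma_in_Un F_fsigma fsigma_in_countable) simp
    moreover have "(t ` I \<union> L) - L = (F a \<union> (t ` I - F a - L)) \<inter> (t ` I \<union> L)"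
      using a(2) by blast
    ultimately have "fsigma_in (top_of_set (t ` I \<union> L)) ((t ` I \<union> L) - L)"
      unfolding fsigma_in_subtopology by metis
    then have "gdelta_in (top_of_set (t ` I \<union> L)) L"
      unfolding gdelta_in_fsigma_in by simp
    moreover have "cantor_set \<inter> (t ` I \<union> L) = t ` I \<union> L"
      using L T_sub by auto
    ultimately show "gdelta_in (subtopology (top_of_set cantor_set) (t ` I \<union> L)) L"
      by (simp add: subtopology_subtopology)
  qed
  ultimately show ?thesis
    using card_of_image by blast
qed

end

lemma lambda_prime_set_aleph1: "\<exists>T. lambda_prime_set_in (top_of_set cantor_set) T \<and> |T| =o aleph1"
proof -
  obtain c g where "tower (Field aleph1) (aleph1 - Id) c g"
    using omega_one.tower_exists[OF omega_one_aleph1] by blast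
  from tower.lambda_prime_set_exists[OF this]
  obtain T where T: "lambda_prime_set_in (top_of_set cantor_set) T" "uncountable T" "|T| \<le>o |Field aleph1|"
    by blast
  then have "|T| \<le>o aleph1"
    using card_of_Field_aleph1 ordLeq_ordIso_trans by blast
  then have "|T| =o aleph1"
    using aleph1_le_uncountable[OF T(2)] ordIso_iff_ordLeq by blast
  then show ?thesis
    using T(1) by blast
qed

section \<open>The bounding number\<close>

text \<open>An eventual bound \<open>g\<close> for all \<open>h i\<close> would split
  \<open>E\<close> into countably many parts, each bounded everywhere by a finite modification of
  \<open>g\<close> and so countable. The lower bound holds because countable families are
  bounded.\<close>

lemma bounding_number_if_countable_on_bounded:
  assumes E: "|E| =o aleph1" and h: "countable_on_bounded E h"
  shows "bounding_number =o aleph1"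
proof -
  have "unbounded_family (h ` E)"
    unfolding unbounded_family_def
  proof
    assume "\<exists>g. \<forall>f\<in>h ` E. eventually_dominated f g"
    then obtain g where g: "\<And>i. i \<in> E \<Longrightarrow> eventually_dominated (h i) g"
      by blast
    have "E \<subseteq> (\<Union>N M. {i \<in> E. \<forall>n. h i n \<le> (if n < N then M else g n)})"
    proof
      fix i assume "i \<in> E"
      then obtain N where N: "\<And>n. N \<le> n \<Longrightarrow> h i n \<le> g n"
        using g[of i] unfolding eventually_dominated_def eventually_sequentially by blast
      \<comment> \<open>The sum of the values before \<open>N\<close> serves as the constant
        \<open>M\<close>.\<close>
      have "h i n \<le> (if n < N then \<Sum>n<N. h i n else g n)" for n
        using N[of n] member_le_sum[of n "{..<N}" "h i"] by auto
      then show "i \<in> (\<Union>N M. {i \<in> E. \<forall>n. h i n \<le> (if n < N then M else g n)})"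
        using \<open>i \<in> E\<close> by blast
    qed
    moreover have "countable (\<Union>N M. {i \<in> E. \<forall>n. h i n \<le> (if n < N then M else g n)})"
      using h by (intro countable_UN) (auto simp: countable_on_bounded_def)
    ultimately show False
      using uncountable_aleph1[OF E] countable_subset by blast
  qed
  then have "bounding_number \<le>o |h ` E|"
    by (rule bounding_number_minimal)
  then have "bounding_number \<le>o aleph1"
    using card_of_image[of h E] E ordLeq_transitive ordLeq_ordIso_trans by blast
  moreover have "aleph1 \<le>o bounding_number"
  proof -
    obtain F where F: "unbounded_family F" "bounding_number = |F|"
      using bounding_number_minimal(1) by blast
    have "uncountable F"
    proof
      assume "countable F"
      from countable_eventually_less[OF this]
      obtain g where "\<And>f. f \<in> F \<Longrightarrow> \<forall>\<^sub>F n in sequentially. f n < g n"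
        by blast
      then have "eventually_dominated f g" if "f \<in> F" for f
        unfolding eventually_dominated_def using that by (blast intro: eventually_mono less_imp_le)
      then show False
        using F(1) unfolding unbounded_family_def by blast
    qed
    then show ?thesis
      unfolding F(2) by (rule aleph1_le_uncountable)
  qed
  ultimately show ?thesis
    using ordIso_iff_ordLeq by blast
qed

text \<open>An uncountable part of the chain is cofinal in it, so a bound for that part eventually
  dominates the whole chain and with it every \<open>u b\<close>.\<close>

lemma (in omega_one) unbounded_imp_countable_on_bounded:
  assumes "unbounded_family (u ` I)"
  shows "\<exists>f. countable_on_bounded I f"
proof -
  obtain f :: "'a \<Rightarrow> nat \<Rightarrow> nat" where f: "\<And>a b. (b, a) \<in> R \<Longrightarrow> \<forall>\<^sub>F n in sequentially. f b n < f a n"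
    "\<And>a. \<forall>\<^sub>F n in sequentially. u a n < f a n"
    using chain_exists[of u] by blast
  have "countable {a \<in> I. \<forall>n. f a n \<le> g n}" for g
  proof (rule ccontr)
    assume Z: "uncountable {a \<in> I. \<forall>n. f a n \<le> g n}"
    have "eventually_dominated (u b) g" if "b \<in> I" for b
    proof -
      have "\<exists>a\<in>{a \<in> I. \<forall>n. f a n \<le> g n}. \<forall>l\<in>{b}. (l, a) \<in> R"
        using \<open>b \<in> I\<close> by (intro upper_bound[OF _ Z]) auto
      then obtain a where a: "(b, a) \<in> R" "\<And>n. f a n \<le> g n"
        by auto
      show ?thesis
        using f(1)[OF a(1)] f(2)[of b] unfolding eventually_dominated_def
      proof eventually_elim
        case (elim n)
        then show ?case
          using a(2)[of n] by linarith
      qed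
    qed
    then show False
      using assms unfolding unbounded_family_def by blast
  qed
  then show ?thesis
    unfolding countable_on_bounded_def by blast
qed

lemma countable_on_bounded_if_bounding_number:
  assumes "bounding_number =o aleph1"
  shows "\<exists>f. countable_on_bounded (Field aleph1) f"
proof -
  obtain F where F: "unbounded_family F" "bounding_number = |F|"
    using bounding_number_minimal(1) by blast
  have "|Field aleph1| =o |F|"
    using card_of_Field_aleph1 assms F(2) ordIso_symmetric ordIso_transitive by metis
  then obtain u where "bij_betw u (Field aleph1) F"
    using card_of_ordIso by blast
  then have "unbounded_family (u ` Field aleph1)"
    using F(1) by (simp add: bij_betw_def)
  then show ?thesis
    by (rule omega_one.unbounded_imp_countable_on_bounded[OF omega_one_aleph1])
qed

section \<open>Equivalence of \<open>C8\<close>, \<open>C9\<close> and the value of the bounding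
  number\<close>

lemma C8_if_C9:
  fixes \<nu> :: "'k rel"
  assumes T: "lambda_prime_set_in (top_of_set cantor_set) T" "|T| =o \<nu>" and "C9 \<nu> aleph1"
  shows "C8 \<nu> aleph1"
proof -
  obtain E :: "real set" and h where E: "|E| =o \<nu>" "countable_on_bounded E h"
    using C9_imp_countable_on_bounded[OF \<open>C9 \<nu> aleph1\<close>] by blast
  \<comment> \<open>Countability of bounded parts depends only on the index set up to bijection, so
    the family moves from \<open>E\<close> to \<open>T\<close>.\<close>
  have "|T| =o |E|"
    using T(2) E(1) ordIso_symmetric ordIso_transitive by blast
  then obtain h' where "countable_on_bounded T h'"
    using countable_on_bounded_reindex[OF E(2)] by blast
  then show ?thesis
    by (rule C8_if_lambda_prime[OF T])
qed

lemma C9_if_C8: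
  fixes \<nu> :: "'k rel"
  shows "C8 \<nu> aleph1 \<Longrightarrow> C9 \<nu> aleph1"
  using C8_imp_countable_on_bounded C9_if_countable_on_bounded by blast

lemma C9_iff_bounding_number: "C9 aleph1 aleph1 \<longleftrightarrow> bounding_number =o aleph1"
proof
  assume "C9 aleph1 aleph1"
  then show "bounding_number =o aleph1"
    using C9_imp_countable_on_bounded bounding_number_if_countable_on_bounded by blast
next
  assume "bounding_number =o aleph1"
  then obtain f where f: "countable_on_bounded (Field aleph1) f"
    using countable_on_bounded_if_bounding_number by blast
  \<comment> \<open>\<open>T\<close> supplies a set of reals of cardinality \<open>aleph1\<close> to
    carry the family.\<close>
  obtain T where T: "lambda_prime_set_in (top_of_set cantor_set) T" "|T| =o aleph1"
    using lambda_prime_set_aleph1 by blast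
  have "|T| =o |Field aleph1|"
    using T(2) card_of_Field_aleph1 ordIso_symmetric ordIso_transitive by blast
  then obtain h where "countable_on_bounded T h"
    using countable_on_bounded_reindex[OF f] by blast
  then show "C9 aleph1 aleph1"
    by (rule C9_if_countable_on_bounded[OF T(2)])
qed

theorem theorem3p10:
  fixes \<nu> :: "'k rel"
  shows
    "(Card_order \<nu> \<and> natLeq <o \<nu> \<and> \<nu> \<le>o continuum \<longrightarrow>
        (\<forall>Q. Q \<subseteq> cantor_set \<and> countable Q \<and> cantor_set \<subseteq> closure Q \<longrightarrow>
          (\<exists>T. lambda_prime_set_in (top_of_set cantor_set) T \<and> |T| =o \<nu>) \<longrightarrow>
          (\<exists>S. K_Lusin_set_in (top_of_set (cantor_set - Q)) S \<and> |S| =o \<nu>) \<longrightarrow>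
          C8 \<nu> aleph1) \<and>
        ((\<exists>T. lambda_prime_set_in (top_of_set cantor_set) T \<and> |T| =o \<nu>) \<longrightarrow>
          (C8 \<nu> aleph1 \<longleftrightarrow> C9 \<nu> aleph1))) \<and>
     (C8 aleph1 aleph1 \<longleftrightarrow> C9 aleph1 aleph1) \<and>
     (C8 aleph1 aleph1 \<longleftrightarrow> bounding_number =o aleph1) \<and>
     (C9 aleph1 aleph1 \<longleftrightarrow> bounding_number =o aleph1)"
proof -
  \<comment> \<open>\<open>S\<close> supplies the family and \<open>T\<close> the topology; they are
    linked only by their common cardinality.\<close>
  have K_Lusin: "C8 \<nu> aleph1"
    if "countable Q" "lambda_prime_set_in (top_of_set cantor_set) T" "|T| =o \<nu>"
      "K_Lusin_set_in (top_of_set (cantor_set - Q)) S" "|S| =o \<nu>" for Q T S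
  proof -
    obtain h where "countable_on_bounded S h"
      using K_Lusin_imp_countable_on_bounded \<open>countable Q\<close> \<open>K_Lusin_set_in _ S\<close> by blast
    then have "C9 \<nu> aleph1"
      by (rule C9_if_countable_on_bounded[OF \<open>|S| =o \<nu>\<close>])
    then show ?thesis
      by (rule C8_if_C9[OF \<open>lambda_prime_set_in _ T\<close> \<open>|T| =o \<nu>\<close>])
  qed
  have "C8 aleph1 aleph1 \<longleftrightarrow> C9 aleph1 aleph1"
    using lambda_prime_set_aleph1 C8_if_C9 C9_if_C8 by blast
  then show ?thesis
    using K_Lusin C8_if_C9 C9_if_C8 C9_iff_bounding_number by blast
qed

end
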